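(* Let $(Q,+)$ be a group, $\varphi,\psi\in Aut(Q,+)$, and $\beta,\gamma\in S_Q$. The quasigroup $(Q,\cdot)$ given by $x\cdot y=\varphi y+\beta x$ and the right linear quasigroup $(Q,\circ)$ given by $x\circ y=\gamma x+\psi y$ are orthogonal if and only if for every $b\in Q$ the map $(I\psi^{-1}\gamma+J_{I\psi^{-1}b}\varphi^{-1}\beta)$, i.e. $x\mapsto-\psi^{-1}\gamma x+J_{I\psi^{-1}b}\varphi^{-1}\beta x$, is a permutation of the set $Q$.
   Context: Groups are written additively but need not be commutative. $S_Q$ is the set of all permutations (bijections) of the set $Q$. Products of maps are compositions, $(\alpha\beta)x=\alpha(\beta x)$. $I$ denotes the map $Ix=-x$, and for $t\in Q$, $J_t$ is the inner automorphism $J_tx=t+x-t$. Two quasigroups $(Q,\cdot)$ and $(Q,\circ)$ on the same set are orthogonal if for all $a,b\in Q$ the system $x\cdot y=a$, $x\circ y=b$ has a unique solution $(x,y)\in Q\times Q$. *)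

theory Defs
  imports Main
begin

text \<open>A group on the set \<open>Q\<close> is rendered as a type of class \<^class>\<open>group_add\<close>, which does not
  assume commutativity; \<open>Q\<close> is the whole type and \<open>S\<^sub>Q\<close> is the set of all \<^const>\<open>bij\<close> maps on it.\<close>

definition quasigroup :: "('a \<Rightarrow> 'a \<Rightarrow> 'a) \<Rightarrow> bool" where
  "quasigroup f \<longleftrightarrow> (\<forall>a b. \<exists>!x. f x a = b) \<and> (\<forall>a b. \<exists>!y. f a y = b)"

text \<open>Orthogonality is a relation between quasigroups, so being a quasigroup is part of it.
  Uniqueness refers to the pair \<open>(x, y)\<close>; the iterated \<open>\<exists>!x. \<exists>!y.\<close> would be a weaker condition.\<close>

definition orthogonal_quasigroups :: "('a \<Rightarrow> 'a \<Rightarrow> 'a) \<Rightarrow> ('a \<Rightarrow> 'a \<Rightarrow> 'a) \<Rightarrow> bool" where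
  "orthogonal_quasigroups f g \<longleftrightarrow> quasigroup f \<and> quasigroup g \<and>
     (\<forall>a b. \<exists>!p. case p of (x, y) \<Rightarrow> f x y = a \<and> g x y = b)"

definition Aut :: "('a::group_add \<Rightarrow> 'a) set" where
  "Aut = {f. bij f \<and> (\<forall>x y. f (x + y) = f x + f y)}"

definition inner_aut :: "'a::group_add \<Rightarrow> 'a \<Rightarrow> 'a" where
  "inner_aut t x = t + x - t"

end

theory Submission
  imports Defs
begin

text \<open>Solving \<open>\<gamma> x + \<psi> y = b\<close> for \<open>y\<close> and substituting into \<open>\<phi> y + \<beta> x = a\<close> leaves one equation
  \<open>T x = \<phi>\<inverse> a - \<psi>\<inverse> b\<close>, where \<open>T\<close> is the map of the theorem taken at \<open>- b\<close>. The change of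
  sign is harmless because \<open>b\<close> ranges over the whole group.\<close>

text \<open>Recasts unique solvability as bijectivity of the translations, so that closure of
  bijections under composition applies.\<close>

lemma quasigroup_iff_bij:
  "quasigroup f \<longleftrightarrow> (\<forall>a. bij (\<lambda>x. f x a)) \<and> (\<forall>a. bij (f a))"
  by (auto simp only: quasigroup_def bij_iff)

lemma Aut_bij: "\<phi> \<in> Aut \<Longrightarrow> bij \<phi>"
  by (simp add: Aut_def)

lemma Aut_add: "\<phi> \<in> Aut \<Longrightarrow> \<phi> (x + y) = \<phi> x + \<phi> y"
  by (simp add: Aut_def)

lemma Aut_inv:
  assumes "\<phi> \<in> Aut"
  shows "inv \<phi> \<in> Aut"
proof -
  have "\<phi> (inv \<phi> x + inv \<phi> y) = x + y" for x y
    using assms by (simp add: Aut_add Aut_bij bij_is_surj surj_f_inv_f)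
  then have "inv \<phi> (x + y) = inv \<phi> x + inv \<phi> y" for x y
    using assms by (simp add: Aut_bij bij_is_inj inv_f_eq)
  then show ?thesis
    using assms by (simp add: Aut_def bij_imp_bij_inv)
qed

lemma Aut_minus:
  assumes "\<phi> \<in> Aut"
  shows "\<phi> (- x) = - \<phi> x"
proof -
  have "\<phi> 0 + \<phi> 0 = \<phi> 0"
    using Aut_add[OF assms, of 0 0] by simp
  then have "\<phi> 0 = 0"
    using add_left_cancel[of "\<phi> 0" "\<phi> 0" 0] by simp
  then show ?thesis
    using Aut_add[OF assms, of "- x" x] by (simp add: eq_neg_iff_add_eq_0)
qed

lemma bij_add_left_comp: "bij f \<Longrightarrow> bij (\<lambda>x. c + f x)" for c :: "'a::group_add"
  using bij_comp[OF _ bij_plus[of c]] by (simp add: comp_def)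

lemma bij_add_right_comp: "bij f \<Longrightarrow> bij (\<lambda>x. f x + c)" for c :: "'a::group_add"
  using bij_comp[OF _ bij_plus_right[of c]] by (simp add: comp_def)

text \<open>On the graph of \<open>g\<close> the first coordinate determines the pair, so uniqueness
  of a pair reduces to uniqueness of \<open>x\<close>.\<close>

lemma ex1_prod_graph_iff:
  "(\<exists>!p. case p of (x, y) \<Rightarrow> P x \<and> y = g x) \<longleftrightarrow> (\<exists>!x. P x)"
  by (auto simp: Ex1_def)

theorem theorem44:
  fixes \<phi> \<psi> \<beta> \<gamma> :: "'a::group_add \<Rightarrow> 'a"
  assumes "\<phi> \<in> Aut" and "\<psi> \<in> Aut" and "bij \<beta>" and "bij \<gamma>"
  shows "orthogonal_quasigroups (\<lambda>x y. \<phi> y + \<beta> x) (\<lambda>x y. \<gamma> x + \<psi> y) \<longleftrightarrow>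
    (\<forall>b. bij (\<lambda>x. - inv \<psi> (\<gamma> x) + inner_aut (- inv \<psi> b) (inv \<phi> (\<beta> x))))"
proof -
  define T where "T b x = - inv \<psi> (\<gamma> x) + inner_aut (- inv \<psi> b) (inv \<phi> (\<beta> x))" for b x
  note inv_\<phi> = Aut_inv[OF assms(1)] and inv_\<psi> = Aut_inv[OF assms(2)]
  \<comment> \<open>Each translation is one of the four given bijections followed by adding a
    constant on one side. Only the unique solvability of the system remains to be studied.\<close>
  have quasi: "quasigroup (\<lambda>x y. \<phi> y + \<beta> x)" "quasigroup (\<lambda>x y. \<gamma> x + \<psi> y)"
    using assms by (auto simp: quasigroup_iff_bij Aut_bij
        intro: bij_add_left_comp bij_add_right_comp)
  \<comment> \<open>Because \<open>inv \<psi>\<close> respects negation, the inner automorphism at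
    \<open>- b\<close> is conjugation by \<open>inv \<psi> b\<close>.\<close>
  have T_neg: "T (- b) x = - inv \<psi> (\<gamma> x) + inv \<psi> b + inv \<phi> (\<beta> x) - inv \<psi> b" for b x
    by (simp only: T_def inner_aut_def Aut_minus[OF inv_\<psi>] minus_minus add_diff_eq add.assoc)
  have system: "\<phi> y + \<beta> x = a \<and> \<gamma> x + \<psi> y = b \<longleftrightarrow>
      T (- b) x = inv \<phi> a - inv \<psi> b \<and> y = - inv \<psi> (\<gamma> x) + inv \<psi> b" for a b x y
  proof -
    have "\<phi> y + \<beta> x = a \<longleftrightarrow> inv \<phi> (\<phi> y + \<beta> x) = inv \<phi> a"
      using Aut_bij[OF inv_\<phi>] by (auto dest: bij_is_inj injD)
    also have "\<dots> \<longleftrightarrow> y + inv \<phi> (\<beta> x) = inv \<phi> a"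
      by (simp add: Aut_add[OF inv_\<phi>] Aut_bij[OF assms(1)] bij_is_inj)
    finally have 1: "\<phi> y + \<beta> x = a \<longleftrightarrow> y + inv \<phi> (\<beta> x) = inv \<phi> a" .
    have "\<gamma> x + \<psi> y = b \<longleftrightarrow> inv \<psi> (\<gamma> x + \<psi> y) = inv \<psi> b"
      using Aut_bij[OF inv_\<psi>] by (auto dest: bij_is_inj injD)
    also have "\<dots> \<longleftrightarrow> inv \<psi> (\<gamma> x) + y = inv \<psi> b"
      by (simp add: Aut_add[OF inv_\<psi>] Aut_bij[OF assms(2)] bij_is_inj)
    also have "\<dots> \<longleftrightarrow> y = - inv \<psi> (\<gamma> x) + inv \<psi> b"
      by (metis add_minus_cancel minus_add_cancel)
    finally have 2: "\<gamma> x + \<psi> y = b \<longleftrightarrow> y = - inv \<psi> (\<gamma> x) + inv \<psi> b" .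
    \<comment> \<open>Inserting \<open>y\<close> from 2 into 1 gives the first three summands of
      \<open>T (- b) x\<close>. Subtracting \<open>inv \<psi> b\<close> on the right of both sides
      completes the conjugation, with no commutativity involved.\<close>
    show ?thesis
      unfolding 1 2 T_neg by (auto simp: diff_eq_eq)
  qed
  have "orthogonal_quasigroups (\<lambda>x y. \<phi> y + \<beta> x) (\<lambda>x y. \<gamma> x + \<psi> y) \<longleftrightarrow>
      (\<forall>b a. \<exists>!x. T (- b) x = inv \<phi> a - inv \<psi> b)"
    \<comment> \<open>The quantifiers are swapped because bijectivity of \<open>T (- b)\<close>
      concerns all \<open>a\<close> at a fixed \<open>b\<close>.\<close>
    by (subst all_comm) (simp only: orthogonal_quasigroups_def system ex1_prod_graph_iff quasi simp_thms)
  also have "\<dots> \<longleftrightarrow> (\<forall>b. bij (T (- b)))"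
  proof -
    \<comment> \<open>For fixed \<open>b\<close> the right-hand side takes every value of the group
      as \<open>a\<close> varies, so unique solvability for all \<open>a\<close> is exactly
      bijectivity of \<open>T (- b)\<close>.\<close>
    have surj: "surj (\<lambda>a. inv \<phi> a - inv \<psi> b)" for b
      using bij_add_right_comp[OF Aut_bij[OF inv_\<phi>], of "- inv \<psi> b"]
      by (simp add: bij_is_surj)
    have "(\<forall>a. \<exists>!x. T (- b) x = inv \<phi> a - inv \<psi> b) \<longleftrightarrow>
        (\<forall>c \<in> range (\<lambda>a. inv \<phi> a - inv \<psi> b). \<exists>!x. T (- b) x = c)" for b
      by (simp only: ball_simps)
    then show ?thesis
      by (simp only: surj bij_iff ball_UNIV)
  qed
  also have "\<dots> \<longleftrightarrow> (\<forall>b. bij (T b))"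
    by (metis minus_minus)
  finally show ?thesis
    unfolding T_def .
qed

end
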